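(* Let $V$ be a finite set of agents, $A$ a finite set of alternatives, $a,b$ two distinct elements of $A$, and let $\mathcal P=\times_{v\in V}\mathcal W_v$ with $\emptyset\ne\mathcal W_v\subseteq\mathcal W(A)$ for every $v\in V$. Let $\chi:\mathcal P\to\mathcal D$ be the function $\chi(P)=\big(D(a,P),I(P),(P_v)_{v\in I(P)}\big)$. Then there is a bijection $\Delta\mapsto\phi_\Delta$ from the set of all antichains $\Delta$ of the poset $\big(\chi(\mathcal P),\le_{\mathcal D}\big)$ onto the set of all weakly group strategy-proof social choice functions from $\mathcal P$ to $\{a,b\}$, where, for an antichain $\Delta$, the function $\phi_\Delta$ is defined by $$\phi_\Delta(P)=\begin{cases} a, & \text{if there is } (S,T,\pi)\in\Delta \text{ with } \big(D(a,P),I(P),(P_v)_{v\in I(P)}\big)\ge_{\mathcal D}(S,T,\pi),\\ b,&\text{otherwise.}\end{cases}$$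
   Context: $\mathcal W(A)$ is the set of all complete, transitive binary relations (preferences) on $A$. For $W\in\mathcal W(A)$: $x\succsim_W y$ means $(x,y)\in W$; $x\succ_W y$ means $(x,y)\in W$ and $(y,x)\notin W$; $x\sim_W y$ means both $(x,y),(y,x)\in W$. A profile is a function $P=(P_v)_{v\in V}$ from $V$ to $\mathcal W(A)$; a partial profile is a function from a subset $T$ of $V$ (possibly empty) to $\mathcal W(A)$. $\mathcal P$ is the set of feasible profiles. A social choice function is a function $\phi:\mathcal P\to A$. It is weakly group strategy-proof if there are no nonempty $D\subseteq V$ and $P,Q\in\mathcal P$ such that $P_v=Q_v$ for all $v\in V\setminus D$ and $\phi(Q)\succ_{P_v}\phi(P)$ for all $v\in D$. $D(a,P)=\{v\in V: a\succ_{P_v} b\}$ and $I(P)=\{v\in V: a\sim_{P_v} b\}$. $\mathcal D$ is the set of triples $(S,T,\pi)$ with $S,T$ disjoint subsets of $V$ and $\pi=(\pi_v)_{v\in T}$ a partial profile with domain $T$. It is partially ordered by: $(S,T,\pi)\le_{\mathcal D}(S',T',\pi')$ iff $S\subseteq S'$, $S\cup T\subseteq S'\cup T'$, and $\pi_v=\pi'_v$ for all $v\in T\cap T'$. $\chi(\mathcal P)$ is the image of $\chi$, with the restricted order. An antichain of a poset is a subset in which no two distinct elements are comparable (the empty set is an antichain). *)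

theory Defs
  imports "HOL-Library.FuncSet"
begin

type_synonym ('v, 'a) profile = "'v \<Rightarrow> 'a rel"

type_synonym ('v, 'a) triple = "'v set \<times> 'v set \<times> ('v, 'a) profile"

definition preferences :: "'a set \<Rightarrow> 'a rel set" where
  "preferences A =
    {W. W \<subseteq> A \<times> A \<and> (\<forall>x\<in>A. \<forall>y\<in>A. (x, y) \<in> W \<or> (y, x) \<in> W) \<and> trans W}"

definition strictly_prefers :: "'a rel \<Rightarrow> 'a \<Rightarrow> 'a \<Rightarrow> bool" where
  "strictly_prefers W x y \<longleftrightarrow> (x, y) \<in> W \<and> (y, x) \<notin> W"

definition indifferent :: "'a rel \<Rightarrow> 'a \<Rightarrow> 'a \<Rightarrow> bool" where
  "indifferent W x y \<longleftrightarrow> (x, y) \<in> W \<and> (y, x) \<in> W"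

text \<open>Profiles, partial profiles and social choice functions are functions with a prescribed
  domain. They are represented as extensional functions (value \<^term>\<open>undefined\<close> off the
  domain), so that equality in HOL is equality of functions on that domain.\<close>

abbreviation feasible_profiles :: "'v set \<Rightarrow> ('v \<Rightarrow> 'a rel set) \<Rightarrow> ('v, 'a) profile set" where
  "feasible_profiles V W \<equiv> PiE V W"

definition weakly_group_strategy_proof ::
  "'v set \<Rightarrow> ('v, 'a) profile set \<Rightarrow> (('v, 'a) profile \<Rightarrow> 'a) \<Rightarrow> bool" where
  "weakly_group_strategy_proof V \<P> \<phi> \<longleftrightarrow>
    \<not> (\<exists>D P Q. D \<noteq> {} \<and> D \<subseteq> V \<and> P \<in> \<P> \<and> Q \<in> \<P> \<and>
        (\<forall>v\<in>V - D. P v = Q v) \<and> (\<forall>v\<in>D. strictly_prefers (P v) (\<phi> Q) (\<phi> P)))"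

definition triples :: "'v set \<Rightarrow> 'a set \<Rightarrow> ('v, 'a) triple set" where
  "triples V A =
    {(S, T, \<pi>). S \<subseteq> V \<and> T \<subseteq> V \<and> S \<inter> T = {} \<and> \<pi> \<in> T \<rightarrow>\<^sub>E preferences A}"

definition triple_order :: "'v set \<Rightarrow> 'a set \<Rightarrow> ('v, 'a) triple rel" where
  "triple_order V A =
    {((S, T, \<pi>), (S', T', \<pi>')).
      (S, T, \<pi>) \<in> triples V A \<and> (S', T', \<pi>') \<in> triples V A \<and>
      S \<subseteq> S' \<and> S \<union> T \<subseteq> S' \<union> T' \<and> (\<forall>v\<in>T \<inter> T'. \<pi> v = \<pi>' v)}"

definition strict_supporters :: "'v set \<Rightarrow> 'a \<Rightarrow> 'a \<Rightarrow> ('v, 'a) profile \<Rightarrow> 'v set" where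
  "strict_supporters V a b P = {v \<in> V. strictly_prefers (P v) a b}"

definition indifferent_agents :: "'v set \<Rightarrow> 'a \<Rightarrow> 'a \<Rightarrow> ('v, 'a) profile \<Rightarrow> 'v set" where
  "indifferent_agents V a b P = {v \<in> V. indifferent (P v) a b}"

definition chi :: "'v set \<Rightarrow> 'a \<Rightarrow> 'a \<Rightarrow> ('v, 'a) profile \<Rightarrow> ('v, 'a) triple" where
  "chi V a b P =
    (strict_supporters V a b P, indifferent_agents V a b P,
     restrict P (indifferent_agents V a b P))"

definition antichains :: "'x set \<Rightarrow> 'x rel \<Rightarrow> 'x set set" where
  "antichains X r =
    {\<Delta>. \<Delta> \<subseteq> X \<and> (\<forall>x\<in>\<Delta>. \<forall>y\<in>\<Delta>. x \<noteq> y \<longrightarrow> (x, y) \<notin> r \<and> (y, x) \<notin> r)}"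

definition scf_of_antichain ::
  "'v set \<Rightarrow> 'a set \<Rightarrow> 'a \<Rightarrow> 'a \<Rightarrow> ('v, 'a) profile set \<Rightarrow> ('v, 'a) triple set
    \<Rightarrow> ('v, 'a) profile \<Rightarrow> 'a" where
  "scf_of_antichain V A a b \<P> \<Delta> =
    (\<lambda>P\<in>\<P>. if \<exists>t\<in>\<Delta>. (t, chi V a b P) \<in> triple_order V A then a else b)"

lemma partial_order_on_triple_order: "partial_order_on (triples V A) (triple_order V A)"
proof -
  have "refl_on (triples V A) (triple_order V A)"
    by (auto simp: refl_on_def triple_order_def)
  moreover have "triple_order V A \<subseteq> triples V A \<times> triples V A"
    by (auto simp: triple_order_def)
  moreover have "antisym (triple_order V A)"
  proof (rule antisymI)
    fix x y
    assume xy: "(x, y) \<in> triple_order V A" "(y, x) \<in> triple_order V A"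
    obtain S T \<pi> S' T' \<pi>' where eqs: "x = (S, T, \<pi>)" "y = (S', T', \<pi>')"
      by (metis prod_cases3)
    have S: "S = S'" and U: "S \<union> T = S' \<union> T'" and eq: "\<And>v. v \<in> T \<inter> T' \<Longrightarrow> \<pi> v = \<pi>' v"
      using xy unfolding eqs triple_order_def by auto
    have disj: "S \<inter> T = {}" "S' \<inter> T' = {}"
      and ext: "\<pi> \<in> T \<rightarrow>\<^sub>E preferences A" "\<pi>' \<in> T' \<rightarrow>\<^sub>E preferences A"
      using xy unfolding eqs triple_order_def triples_def by auto
    have T: "T = T'" using S U disj by blast
    have "\<pi> = \<pi>'"
      by (rule PiE_ext[OF ext(1)]) (use ext eq T in auto)
    with S T show "x = y" by (simp add: eqs)
  qed
  moreover have "trans (triple_order V A)"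
  proof (rule transI)
    fix x y z
    assume xyz: "(x, y) \<in> triple_order V A" "(y, z) \<in> triple_order V A"
    obtain S T \<pi> S' T' \<pi>' S'' T'' \<pi>''
      where eqs: "x = (S, T, \<pi>)" "y = (S', T', \<pi>')" "z = (S'', T'', \<pi>'')"
      by (metis prod_cases3)
    have mem: "x \<in> triples V A" "z \<in> triples V A"
      and S: "S \<subseteq> S'" "S' \<subseteq> S''" and U: "S \<union> T \<subseteq> S' \<union> T'" "S' \<union> T' \<subseteq> S'' \<union> T''"
      and eq: "\<And>v. v \<in> T \<inter> T' \<Longrightarrow> \<pi> v = \<pi>' v" "\<And>v. v \<in> T' \<inter> T'' \<Longrightarrow> \<pi>' v = \<pi>'' v"
      using xyz unfolding eqs triple_order_def by auto
    have "S'' \<inter> T'' = {}" using mem by (simp add: eqs triples_def)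
    then have "T \<inter> T'' \<subseteq> T'" using S U by blast
    then have "\<forall>v\<in>T \<inter> T''. \<pi> v = \<pi>'' v" using eq by (metis IntD1 IntD2 IntI subsetD)
    moreover have "S \<subseteq> S''" "S \<union> T \<subseteq> S'' \<union> T''"
      by (rule subset_trans, rule S, rule S, rule subset_trans, rule U, rule U)
    ultimately show "(x, z) \<in> triple_order V A"
      using mem by (simp add: eqs triple_order_def)
  qed
  ultimately show ?thesis
    by (simp add: partial_order_on_def preorder_on_def)
qed

lemma chi_in_triples:
  assumes "P \<in> feasible_profiles V W" "\<forall>v\<in>V. W v \<subseteq> preferences A"
  shows "chi V a b P \<in> triples V A"
proof -
  have "restrict P (indifferent_agents V a b P) \<in>
      indifferent_agents V a b P \<rightarrow>\<^sub>E preferences A"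
    using assms by (force simp: indifferent_agents_def PiE_iff)
  then show ?thesis
    by (simp add: chi_def triples_def strict_supporters_def indifferent_agents_def
        strictly_prefers_def indifferent_def disjoint_iff)
qed

end

theory Submission
  imports Defs
begin

text \<open>The proof rests on the fact that a function \<^term>\<open>\<phi>\<close> into \<open>{a, b}\<close> is weakly group
  strategy-proof iff the set of profiles with outcome \<open>a\<close> is upward closed with respect to the
  order pulled back along \<open>\<chi>\<close>. A manipulation towards or away from \<open>a\<close> moves the triple down or
  up, respectively, so it contradicts upward closedness. Conversely, a step up from \<open>P\<close> to \<open>Q\<close>
  factors through the profile \<open>R\<close> that agrees with \<open>Q\<close> on the strict supporters of \<open>a\<close> in \<open>Q\<close>
  and with \<open>P\<close> elsewhere: losing \<open>a\<close> from \<open>P\<close> to \<open>R\<close> would let the changed agents, who prefer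
  \<open>a\<close> at \<open>R\<close>, manipulate back, and losing it from \<open>R\<close> to \<open>Q\<close> would let the changed agents, who
  prefer \<open>b\<close> at \<open>R\<close>, manipulate forward. Finally, up-sets of a finite poset correspond to
  antichains via minimal elements.\<close>

section \<open>Antichains and the up-sets they generate\<close>

text \<open>Any \<open>x\<close> in \<open>\<Delta>\<close> lies above some \<open>y\<close> in
  \<open>\<Gamma>\<close>, which lies above some \<open>z\<close> in \<open>\<Delta>\<close>. The
  antichain property forces \<open>z = x\<close>, and antisymmetry then gives \<open>x = y\<close>.
  Used in both directions, this yields injectivity.\<close>

lemma antichain_subset_if_same_upset:
  assumes po: "partial_order_on Y r" and "X \<subseteq> Y"
    and \<Delta>: "\<Delta> \<in> antichains X r" and \<Gamma>: "\<Gamma> \<in> antichains X r"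
    and same: "\<And>x. x \<in> X \<Longrightarrow> (\<exists>t\<in>\<Delta>. (t, x) \<in> r) \<longleftrightarrow> (\<exists>t\<in>\<Gamma>. (t, x) \<in> r)"
  shows "\<Delta> \<subseteq> \<Gamma>"
proof
  have refl: "\<And>x. x \<in> Y \<Longrightarrow> (x, x) \<in> r" and "antisym r" and "trans r"
    using po by (auto simp: partial_order_on_def preorder_on_def refl_on_def)
  fix x assume x: "x \<in> \<Delta>"
  then have "x \<in> X" using \<Delta> by (auto simp: antichains_def)
  then have "\<exists>t\<in>\<Delta>. (t, x) \<in> r" using x refl \<open>X \<subseteq> Y\<close> by blast
  then obtain y where y: "y \<in> \<Gamma>" "(y, x) \<in> r" using same[OF \<open>x \<in> X\<close>] by blast
  then have "y \<in> X" using \<Gamma> by (auto simp: antichains_def)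
  then have "\<exists>t\<in>\<Gamma>. (t, y) \<in> r" using y refl \<open>X \<subseteq> Y\<close> by blast
  then obtain z where z: "z \<in> \<Delta>" "(z, y) \<in> r" using same[OF \<open>y \<in> X\<close>] by blast
  have "(z, x) \<in> r" using z y \<open>trans r\<close> by (blast dest: transD)
  then have "z = x" using \<Delta> x z by (auto simp: antichains_def)
  then have "x = y" using z y \<open>antisym r\<close> by (blast dest: antisymD)
  then show "x \<in> \<Gamma>" using y by simp
qed

text \<open>The minimal elements of \<open>U\<close> form the antichain; finiteness of
  \<open>X\<close> puts one of them below every element of \<open>U\<close>.\<close>

lemma upset_generated_by_antichain:
  assumes "finite X" and po: "partial_order_on Y r" and "U \<subseteq> X"
    and "X \<subseteq> Y"
    and up: "\<And>x y. x \<in> U \<Longrightarrow> y \<in> X \<Longrightarrow> (x, y) \<in> r \<Longrightarrow> y \<in> U"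
  shows "\<exists>\<Delta>\<in>antichains X r. \<forall>x\<in>X. (\<exists>t\<in>\<Delta>. (t, x) \<in> r) \<longleftrightarrow> x \<in> U"
proof (intro bexI ballI)
  have refl: "\<And>x. x \<in> Y \<Longrightarrow> (x, x) \<in> r" and "antisym r" and "trans r"
    using po by (auto simp: partial_order_on_def preorder_on_def refl_on_def)
  let ?\<Delta> = "{m \<in> U. \<forall>y\<in>U. (y, m) \<in> r \<longrightarrow> y = m}"
  show "?\<Delta> \<in> antichains X r"
    using \<open>U \<subseteq> X\<close> by (auto simp: antichains_def)
  fix x assume "x \<in> X"
  show "(\<exists>t\<in>?\<Delta>. (t, x) \<in> r) \<longleftrightarrow> x \<in> U"
  proof
    assume "\<exists>t\<in>?\<Delta>. (t, x) \<in> r"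
    then show "x \<in> U" using up \<open>x \<in> X\<close> by blast
  next
    assume "x \<in> U"
    \<comment> \<open>Minimising only over the part of \<open>U\<close> below \<open>x\<close> keeps
      the minimal element below \<open>x\<close>.\<close>
    let ?L = "{y \<in> U. (y, x) \<in> r}"
    let ?less = "\<lambda>y z. (y, z) \<in> r \<and> y \<noteq> z"
    have "finite ?L" using \<open>finite X\<close> \<open>U \<subseteq> X\<close> by (auto intro: finite_subset)
    moreover have "asymp_on ?L ?less"
      using \<open>antisym r\<close> by (auto intro!: asymp_onI dest: antisymD)
    moreover have "transp_on ?L ?less"
      using \<open>trans r\<close> \<open>antisym r\<close>
      by (intro transp_onI) (metis antisymD transD)
    moreover have "?L \<noteq> {}"
      using \<open>x \<in> U\<close> \<open>x \<in> X\<close> \<open>X \<subseteq> Y\<close> refl by blast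
    ultimately obtain m where m: "m \<in> ?L" and min: "\<forall>y\<in>?L. y \<noteq> m \<longrightarrow> \<not> ?less y m"
      using Finite_Set.bex_min_element[of ?L ?less] by blast
    \<comment> \<open>Whatever lies below \<open>m\<close> lies below \<open>x\<close>, so
      minimality in \<open>?L\<close> is minimality in all of \<open>U\<close>.\<close>
    have "(y, x) \<in> r" if "(y, m) \<in> r" for y
      using that m \<open>trans r\<close> by (blast dest: transD)
    then have "m \<in> ?\<Delta>" using m min by blast
    then show "\<exists>t\<in>?\<Delta>. (t, x) \<in> r" using m by blast
  qed
qed

section \<open>Strategy-proofness as monotonicity along \<open>chi\<close>\<close>

lemma chi_le_chi_iff:
  assumes "P \<in> feasible_profiles V W" "Q \<in> feasible_profiles V W"
    and "\<forall>v\<in>V. W v \<subseteq> preferences A"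
  shows "(chi V a b P, chi V a b Q) \<in> triple_order V A \<longleftrightarrow>
    (\<forall>v\<in>V. (strictly_prefers (P v) a b \<longrightarrow> strictly_prefers (Q v) a b) \<and>
      (indifferent (P v) a b \<longrightarrow>
        strictly_prefers (Q v) a b \<or> (indifferent (Q v) a b \<and> P v = Q v)))"
proof -
  let ?S = "strict_supporters V a b" and ?T = "indifferent_agents V a b"
  have "(chi V a b P, chi V a b Q) \<in> triple_order V A \<longleftrightarrow>
      ?S P \<subseteq> ?S Q \<and> ?S P \<union> ?T P \<subseteq> ?S Q \<union> ?T Q \<and> (\<forall>v\<in>?T P \<inter> ?T Q. P v = Q v)"
    using chi_in_triples[OF assms(1,3), of a b] chi_in_triples[OF assms(2,3), of a b]
    by (simp add: triple_order_def chi_def)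
  \<comment> \<open>For an agent indifferent at both profiles this excludes the first disjunct,
    leaving \<open>P v = Q v\<close>.\<close>
  moreover have "\<not> (strictly_prefers (Q v) a b \<and> indifferent (Q v) a b)" for v
    by (simp add: strictly_prefers_def indifferent_def)
  ultimately show ?thesis
    unfolding strict_supporters_def indifferent_agents_def by blast
qed

lemma not_strictly_prefers_self: "\<not> strictly_prefers R x x"
  by (simp add: strictly_prefers_def)

lemma weakly_group_strategy_proof_iff_monotone:
  fixes W :: "'v \<Rightarrow> 'a rel set"
  assumes "a \<in> A" "b \<in> A" "a \<noteq> b" and W: "\<forall>v\<in>V. W v \<subseteq> preferences A"
    and \<phi>: "\<phi> \<in> feasible_profiles V W \<rightarrow> {a, b}"
  shows "weakly_group_strategy_proof V (feasible_profiles V W) \<phi> \<longleftrightarrow>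
    (\<forall>P\<in>feasible_profiles V W. \<forall>Q\<in>feasible_profiles V W.
      \<phi> P = a \<longrightarrow> (chi V a b P, chi V a b Q) \<in> triple_order V A \<longrightarrow> \<phi> Q = a)"
    (is "?sp \<longleftrightarrow> ?mono")
proof
  assume sp: ?sp
  \<comment> \<open>Strategy-proofness for the coalition of exactly the agents whose preferences
    change. It is nonempty if the outcomes differ, since profiles agreeing on \<open>V\<close> are
    equal.\<close>
  have no_manipulation: "\<phi> P = \<phi> Q"
    if "P \<in> feasible_profiles V W" "Q \<in> feasible_profiles V W"
      and "\<And>v. v \<in> V \<Longrightarrow> P v \<noteq> Q v \<Longrightarrow> strictly_prefers (P v) (\<phi> Q) (\<phi> P)" for P Q
  proof (rule ccontr)
    assume "\<phi> P \<noteq> \<phi> Q"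
    let ?D = "{v \<in> V. P v \<noteq> Q v}"
    have "?D \<noteq> {}"
      using \<open>\<phi> P \<noteq> \<phi> Q\<close> PiE_ext[OF that(1,2)] by blast
    then have "\<exists>D P Q. D \<noteq> {} \<and> D \<subseteq> V \<and> P \<in> feasible_profiles V W \<and>
        Q \<in> feasible_profiles V W \<and> (\<forall>v\<in>V - D. P v = Q v) \<and>
        (\<forall>v\<in>D. strictly_prefers (P v) (\<phi> Q) (\<phi> P))"
      using that by (intro exI[of _ ?D] exI[of _ P] exI[of _ Q]) auto
    then show False using sp unfolding weakly_group_strategy_proof_def by contradiction
  qed
  show ?mono
  proof (intro ballI impI)
    fix P Q
    assume P: "P \<in> feasible_profiles V W" and Q: "Q \<in> feasible_profiles V W"
      and "\<phi> P = a" and le: "(chi V a b P, chi V a b Q) \<in> triple_order V A"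
    define R where "R v = (if strictly_prefers (Q v) a b then Q v else P v)" for v
    \<comment> \<open>Mixing two profiles agent by agent stays feasible because the feasible set is
      a product.\<close>
    have R: "R \<in> feasible_profiles V W"
      using P Q by (auto simp: R_def PiE_iff extensional_def)
    have "\<phi> R = a"
    proof (rule ccontr)
      assume "\<phi> R \<noteq> a"
      then have "\<phi> R = b" using \<phi> R by auto
      then have "\<phi> R = \<phi> P"
        using \<open>\<phi> P = a\<close> by (intro no_manipulation R P) (auto simp: R_def split: if_splits)
      then show False using \<open>\<phi> R \<noteq> a\<close> \<open>\<phi> P = a\<close> by simp
    qed
    show "\<phi> Q = a"
    proof (rule ccontr)
      assume "\<phi> Q \<noteq> a"
      then have "\<phi> Q = b" using \<phi> Q by auto
      \<comment> \<open>Such an agent keeps \<open>P v\<close> and does not strictly prefer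
        \<open>a\<close> at \<open>Q\<close>. By \<open>le\<close>, strict preference for
        \<open>a\<close> at \<open>P\<close> is impossible, and indifference would force
        \<open>P v = Q v\<close>; completeness leaves only strict preference for
        \<open>b\<close>.\<close>
      have "strictly_prefers (R v) b a" if v: "v \<in> V" "R v \<noteq> Q v" for v
      proof -
        have eq: "R v = P v" and "\<not> strictly_prefers (Q v) a b"
          using v by (auto simp: R_def split: if_splits)
        then have "\<not> strictly_prefers (P v) a b" "\<not> indifferent (P v) a b"
          using le v unfolding chi_le_chi_iff[OF P Q W] by auto
        moreover have "P v \<in> preferences A" using P W v by blast
        ultimately show ?thesis
          using \<open>a \<in> A\<close> \<open>b \<in> A\<close>
          by (auto simp: eq preferences_def strictly_prefers_def indifferent_def)
      qed
      then have "\<phi> R = \<phi> Q"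
        using \<open>\<phi> R = a\<close> \<open>\<phi> Q = b\<close> by (intro no_manipulation R Q) auto
      then show False using \<open>\<phi> Q \<noteq> a\<close> \<open>\<phi> R = a\<close> by simp
    qed
  qed
next
  assume mono: ?mono
  show ?sp
    unfolding weakly_group_strategy_proof_def
  proof (intro notI, elim exE conjE)
    fix D P Q
    assume "D \<noteq> {}" "D \<subseteq> V"
      and P: "P \<in> feasible_profiles V W" and Q: "Q \<in> feasible_profiles V W"
      and eq: "\<forall>v\<in>V - D. P v = Q v"
      and gain: "\<forall>v\<in>D. strictly_prefers (P v) (\<phi> Q) (\<phi> P)"
    have ne: "\<phi> Q \<noteq> \<phi> P"
      using \<open>D \<noteq> {}\<close> gain not_strictly_prefers_self by fastforce
    then consider "\<phi> Q = a" "\<phi> P = b" | "\<phi> Q = b" "\<phi> P = a"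
      using funcset_mem[OF \<phi> P] funcset_mem[OF \<phi> Q] by auto
    then show False
    proof cases
      case 1
      \<comment> \<open>Members of \<open>D\<close> are strict supporters of \<open>a\<close> at
        \<open>P\<close>, whatever they report in \<open>Q\<close>; all others are
        unchanged.\<close>
      have "(chi V a b Q, chi V a b P) \<in> triple_order V A"
        unfolding chi_le_chi_iff[OF Q P W] using eq gain 1 by (metis DiffI)
      then show False using mono P Q 1 ne by metis
    next
      case 2
      \<comment> \<open>Members of \<open>D\<close> strictly prefer \<open>b\<close> at
        \<open>P\<close>, so the order leaves their preferences in \<open>Q\<close>
        unconstrained.\<close>
      have "\<not> strictly_prefers (P v) a b" "\<not> indifferent (P v) a b" if "v \<in> D" for v
        using gain 2 that by (auto simp: strictly_prefers_def indifferent_def)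
      then have "(chi V a b P, chi V a b Q) \<in> triple_order V A"
        unfolding chi_le_chi_iff[OF P Q W] using eq by (metis DiffI)
      then show False using mono P Q 2 ne by metis
    qed
  qed
qed

section \<open>The bijection\<close>

theorem theorem3p17:
  fixes V :: "'v set" and A :: "'a set" and a b :: 'a and W :: "'v \<Rightarrow> 'a rel set"
    and \<P> :: "('v, 'a) profile set"
  assumes "finite V" and "finite A"
    and "a \<in> A" and "b \<in> A" and "a \<noteq> b"
    and "\<forall>v\<in>V. W v \<noteq> {} \<and> W v \<subseteq> preferences A"
    and "\<P> = feasible_profiles V W"
  shows "bij_betw (scf_of_antichain V A a b \<P>)
    (antichains (chi V a b ` \<P>) (triple_order V A))
    {\<phi> \<in> \<P> \<rightarrow>\<^sub>E {a, b}. weakly_group_strategy_proof V \<P> \<phi>}"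
proof -
  let ?r = "triple_order V A" and ?\<chi> = "chi V a b"
  let ?f = "scf_of_antichain V A a b \<P>"
  have W: "\<forall>v\<in>V. W v \<subseteq> preferences A" using assms(6) by blast
  note po = partial_order_on_triple_order[of V A]
  have "trans ?r" and refl: "\<And>x. x \<in> triples V A \<Longrightarrow> (x, x) \<in> ?r"
    using po by (auto simp: partial_order_on_def preorder_on_def refl_on_def)
  have sub: "?\<chi> ` \<P> \<subseteq> triples V A"
    using chi_in_triples[OF _ W] assms(7) by blast
  have "preferences A \<subseteq> Pow (A \<times> A)" by (auto simp: preferences_def)
  then have "finite (preferences A)" using \<open>finite A\<close> by (auto intro: finite_subset)
  then have fin: "finite (?\<chi> ` \<P>)"
    unfolding assms(7) using W \<open>finite V\<close>
    by (intro finite_imageI finite_PiE) (auto intro: finite_subset)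
  have sp_iff: "weakly_group_strategy_proof V \<P> \<phi> \<longleftrightarrow>
      (\<forall>P\<in>\<P>. \<forall>Q\<in>\<P>. \<phi> P = a \<longrightarrow> (?\<chi> P, ?\<chi> Q) \<in> ?r \<longrightarrow> \<phi> Q = a)"
    if "\<phi> \<in> \<P> \<rightarrow> {a, b}" for \<phi>
    using weakly_group_strategy_proof_iff_monotone[OF assms(3-5) W] that
    unfolding assms(7) by blast
  have f_eq_a: "?f \<Delta> P = a \<longleftrightarrow> (\<exists>t\<in>\<Delta>. (t, ?\<chi> P) \<in> ?r)" if "P \<in> \<P>" for \<Delta> P
    using that \<open>a \<noteq> b\<close> by (simp add: scf_of_antichain_def)
  have f_in: "?f \<Delta> \<in> \<P> \<rightarrow>\<^sub>E {a, b}" for \<Delta>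
    by (auto simp: scf_of_antichain_def)
  show ?thesis
  proof (rule bij_betw_imageI)
    show "inj_on ?f (antichains (?\<chi> ` \<P>) ?r)"
    proof (rule inj_onI)
      fix \<Delta> \<Gamma>
      assume \<Delta>: "\<Delta> \<in> antichains (?\<chi> ` \<P>) ?r" and \<Gamma>: "\<Gamma> \<in> antichains (?\<chi> ` \<P>) ?r"
        and "?f \<Delta> = ?f \<Gamma>"
      \<comment> \<open>As \<open>a \<noteq> b\<close>, the profiles with value \<open>a\<close>
        recover the up-set generated inside the image of \<open>chi\<close>.\<close>
      then have same: "(\<exists>t\<in>\<Delta>. (t, x) \<in> ?r) \<longleftrightarrow> (\<exists>t\<in>\<Gamma>. (t, x) \<in> ?r)"
        if "x \<in> ?\<chi> ` \<P>" for x
        using that f_eq_a[of _ \<Delta>] f_eq_a[of _ \<Gamma>] by auto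
      show "\<Delta> = \<Gamma>"
        using antichain_subset_if_same_upset[OF po sub \<Delta> \<Gamma>]
          antichain_subset_if_same_upset[OF po sub \<Gamma> \<Delta>] same by blast
    qed
    show "?f ` antichains (?\<chi> ` \<P>) ?r =
      {\<phi> \<in> \<P> \<rightarrow>\<^sub>E {a, b}. weakly_group_strategy_proof V \<P> \<phi>}"
    proof (intro equalityI subsetI)
      fix \<phi> assume "\<phi> \<in> ?f ` antichains (?\<chi> ` \<P>) ?r"
      then obtain \<Delta> where \<phi>: "\<phi> = ?f \<Delta>" by blast
      have "?f \<Delta> \<in> \<P> \<rightarrow> {a, b}" using f_in by (simp add: PiE_def)
      then have "weakly_group_strategy_proof V \<P> \<phi>"
        \<comment> \<open>By transitivity the set generated by \<open>\<Delta>\<close> is upward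
          closed, which is the monotonicity in \<open>sp_iff\<close>.\<close>
        unfolding \<phi> using \<open>trans ?r\<close>
        by (subst sp_iff) (auto simp: f_eq_a dest: transD)
      then show "\<phi> \<in> {\<phi> \<in> \<P> \<rightarrow>\<^sub>E {a, b}. weakly_group_strategy_proof V \<P> \<phi>}"
        using f_in \<phi> by blast
    next
      fix \<phi> assume "\<phi> \<in> {\<phi> \<in> \<P> \<rightarrow>\<^sub>E {a, b}. weakly_group_strategy_proof V \<P> \<phi>}"
      then have \<phi>: "\<phi> \<in> \<P> \<rightarrow>\<^sub>E {a, b}" and sp: "weakly_group_strategy_proof V \<P> \<phi>"
        by auto
      have "\<phi> \<in> \<P> \<rightarrow> {a, b}" using \<phi> by (simp add: PiE_def)
      then have mono: "\<phi> Q = a" if "P \<in> \<P>" "Q \<in> \<P>" "\<phi> P = a" "(?\<chi> P, ?\<chi> Q) \<in> ?r" for P Q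
        using sp_iff sp that by blast
      let ?U = "?\<chi> ` {P \<in> \<P>. \<phi> P = a}"
      have U: "?U \<subseteq> ?\<chi> ` \<P>" by blast
      have up: "y \<in> ?U" if "x \<in> ?U" "y \<in> ?\<chi> ` \<P>" "(x, y) \<in> ?r" for x y
        using that mono by blast
      have "\<exists>\<Delta>\<in>antichains (?\<chi> ` \<P>) ?r.
          \<forall>x\<in>?\<chi> ` \<P>. (\<exists>t\<in>\<Delta>. (t, x) \<in> ?r) \<longleftrightarrow> x \<in> ?U"
        by (rule upset_generated_by_antichain[OF fin po U sub]) (rule up)
      then obtain \<Delta> where \<Delta>: "\<Delta> \<in> antichains (?\<chi> ` \<P>) ?r"
        and gen: "\<forall>x\<in>?\<chi> ` \<P>. (\<exists>t\<in>\<Delta>. (t, x) \<in> ?r) \<longleftrightarrow> x \<in> ?U"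
        by (rule bexE)
      have "\<phi> = ?f \<Delta>"
      proof (rule PiE_ext[OF \<phi> f_in])
        fix P assume P: "P \<in> \<P>"
        \<comment> \<open>\<open>\<phi>\<close> depends on \<open>P\<close> only through its triple:
          equal triples are comparable by reflexivity, so \<open>mono\<close> carries the value
          \<open>a\<close> across.\<close>
        have "?\<chi> P \<in> ?U \<longleftrightarrow> \<phi> P = a"
        proof
          assume "?\<chi> P \<in> ?U"
          then obtain Q where Q: "Q \<in> \<P>" "\<phi> Q = a" "?\<chi> P = ?\<chi> Q" by blast
          then show "\<phi> P = a" using mono[OF Q(1) P Q(2)] refl sub P by (metis image_subset_iff)
        qed (use P in blast)
        then have "?f \<Delta> P = a \<longleftrightarrow> \<phi> P = a" using f_eq_a gen P by blast
        moreover have "?f \<Delta> P \<in> {a, b}" "\<phi> P \<in> {a, b}"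
          using f_in[of \<Delta>] \<phi> P by auto
        ultimately show "\<phi> P = ?f \<Delta> P" by auto
      qed
      then show "\<phi> \<in> ?f ` antichains (?\<chi> ` \<P>) ?r" using \<Delta> by blast
    qed
  qed
qed

end
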